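(* For any finite dimensional normed vector space $X$, $(0,1)\subset\mathcal A(X,c)$.
   Context: $c$ denotes the space of all real converging sequences, equipped with the supremum norm. For metric spaces $(X,d)$, $(Y,\varrho)$, $\alpha\in(0,1]$ and $K>0$, a map $f:X\to Y$ is called $(K,\alpha)$-Hölder if $\varrho(f(x),f(y))\le K d(x,y)^\alpha$ for all $x,y\in X$. $\mathcal A(X,Y)$ denotes the set of all $\alpha\in(0,1]$ such that for every $K>0$ and every subset $M\subset X$, any $(K,\alpha)$-Hölder function $f:M\to Y$ can be extended to a $(K,\alpha)$-Hölder function from $X$ into $Y$ (same constant $K$). Normed spaces are viewed as metric spaces with the norm distance. *)

theory Defs
  imports "HOL-Analysis.Analysis"
begin

definition holder_on :: "real \<Rightarrow> real \<Rightarrow> 'a::metric_space set \<Rightarrow> ('a \<Rightarrow> 'b::metric_space) \<Rightarrow> bool" where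
  "holder_on K \<alpha> M f \<longleftrightarrow> (\<forall>x\<in>M. \<forall>y\<in>M. dist (f x) (f y) \<le> K * dist x y powr \<alpha>)"

text \<open>The set \<open>\<A>(X,Y)\<close>. The metric spaces \<open>X\<close> and \<open>Y\<close> are given as subsets of ambient metric types,
  with the induced distances.\<close>

definition holder_extension_exponents ::
    "'a::metric_space set \<Rightarrow> 'b::metric_space set \<Rightarrow> real set" where
  "holder_extension_exponents X Y =
    {\<alpha>. 0 < \<alpha> \<and> \<alpha> \<le> 1 \<and>
      (\<forall>K>0. \<forall>M\<subseteq>X. \<forall>f. f \<in> M \<rightarrow> Y \<and> holder_on K \<alpha> M f \<longrightarrow>
        (\<exists>g. g \<in> X \<rightarrow> Y \<and> holder_on K \<alpha> X g \<and> (\<forall>x\<in>M. g x = f x)))}"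

text \<open>Since \<open>nat\<close> is discrete, \<^typ>\<open>nat \<Rightarrow>\<^sub>C real\<close> is the space of all bounded real sequences with
  the supremum norm; \<open>c\<close> is its subspace of convergent sequences. The two lemmas below confirm that
  no convergent sequence is lost and that the norm is the expected one.\<close>

definition c_space :: "(nat \<Rightarrow>\<^sub>C real) set" where
  "c_space = {u. convergent (apply_bcontfun u)}"

lemma apply_bcontfun_image_c_space: "apply_bcontfun ` c_space = {x. convergent x}"
proof -
  have "x \<in> apply_bcontfun ` c_space" if "convergent x" for x :: "nat \<Rightarrow> real"
  proof -
    have "bounded (range x)"
      using that convergent_imp_Bseq Bseq_eq_bounded by blast
    then have "x \<in> bcontfun"
      by (auto simp: bcontfun_def)
    then have "apply_bcontfun (Bcontfun x) = x"
      by (rule Bcontfun_inverse)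
    with that show ?thesis
      unfolding c_space_def by (intro image_eqI[of _ _ "Bcontfun x"]) auto
  qed
  then show ?thesis
    by (auto simp: c_space_def)
qed

lemma norm_bounded_sequence: "norm u = (SUP n. \<bar>apply_bcontfun u n\<bar>)" for u :: "nat \<Rightarrow>\<^sub>C real"
  by (simp add: norm_bcontfun_def dist_bcontfun.rep_eq zero_bcontfun.rep_eq)

end

theory Submission
  imports Defs "HOL-Real_Asymp.Real_Asymp"
begin

text \<open>By Zorn's lemma it suffices to extend a map \<open>f = (f\<^sub>n)\<close> from \<open>M\<close> to one further point \<open>z\<close>.
  The admissible values for the \<open>n\<close>-th coordinate form the interval \<open>[a\<^sub>n, b\<^sub>n]\<close>, where
  \<open>a\<^sub>n = sup\<^sub>x (f\<^sub>n x - K d(z,x)\<^sup>\<alpha>)\<close> and \<open>b\<^sub>n = inf\<^sub>x (f\<^sub>n x + K d(z,x)\<^sup>\<alpha>)\<close>, and a convergent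
  selection exists once some \<open>L\<close> satisfies \<open>limsup a\<^sub>n \<le> L \<le> liminf b\<^sub>n\<close>. On bounded parts of \<open>M\<close>, which
  are totally bounded, \<open>f\<^sub>n\<close> converges uniformly to its limit \<open>F\<close>, so points there only require that
  \<open>L\<close> be an admissible value for \<open>F\<close>. Since \<open>\<alpha> < 1\<close>, the difference \<open>d(w,x)\<^sup>\<alpha> - d(z,x)\<^sup>\<alpha>\<close> tends to
  \<open>0\<close> as \<open>x\<close> tends to infinity, so distant points only require \<open>inf F \<le> L \<le> sup F\<close>. Both requirements can be
  met simultaneously.\<close>

section \<open>Compactness of closed balls in finite dimension\<close>

text \<open>Induction on \<open>B\<close>: a vector \<open>b\<close> outside \<open>span B\<close>
  has positive distance from it. This bounds the coefficient of \<open>b\<close>, so the ball is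
  covered by a continuous image of a product of two compact sets.\<close>

lemma compact_cball_Int_span:
  fixes B :: "'a::real_normed_vector set"
  assumes "finite B"
  shows "compact (cball 0 r \<inter> span B)"
  using assms
proof (induction B arbitrary: r)
  case empty
  have "cball 0 r \<inter> span {} \<subseteq> {0::'a}"
    by auto
  then show ?case
    by (meson finite.emptyI finite_imp_compact finite_insert finite_subset)
next
  case (insert b B)
  show ?case
  proof (cases "b \<in> span B")
    case True
    then show ?thesis
      using insert.IH by (simp add: span_redundant)
  next
    case False
    \<comment> \<open>A convergent sequence is bounded, so it stays in a ball whose intersection
      with \<open>span B\<close> is compact by the induction hypothesis.\<close>
    have closed_span: "closed (span B)"
      unfolding closed_sequential_limits
    proof (intro allI impI, elim conjE)
      fix s l
      assume s: "\<forall>n. s n \<in> span B" and lim: "s \<longlonglongrightarrow> l"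
      from lim have "Bseq s"
        using convergentI convergent_imp_Bseq by blast
      then obtain k where "\<forall>n. norm (s n) \<le> k"
        by (auto simp: Bseq_def)
      then have "\<forall>n. s n \<in> cball 0 k \<inter> span B"
        using s by simp
      then show "l \<in> span B"
        using compact_imp_closed[OF insert.IH] lim closed_sequentially by blast
    qed
    define \<delta> where "\<delta> = infdist b (span B)"
    have ne: "span B \<noteq> {}"
      using span_zero by blast
    have \<delta>: "\<delta> > 0"
      using in_closed_iff_infdist_zero[OF closed_span ne, of b] False infdist_nonneg[of b "span B"]
      by (auto simp: \<delta>_def)
    define \<rho> where "\<rho> = r / \<delta>"
    define C where "C = {-\<rho>..\<rho>} \<times> (cball 0 (r + \<rho> * norm b) \<inter> span B)"
    define h where "h = (\<lambda>p. fst p *\<^sub>R b + snd p)"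
    have "cball 0 r \<inter> span (insert b B) = cball 0 r \<inter> h ` C"
    proof (intro equalityI subsetI)
      fix x
      assume x: "x \<in> cball 0 r \<inter> span (insert b B)"
      then obtain t where t: "x - t *\<^sub>R b \<in> span B"
        using span_breakdown_eq by blast
      have "\<bar>t\<bar> * \<delta> \<le> norm x"
      proof (cases "t = 0")
        case False
        \<comment> \<open>This vector is \<open>b - (1 / t) *\<^sub>R x\<close>, hence at distance
          \<open>norm x / \<bar>t\<bar>\<close> from \<open>b\<close>.\<close>
        have "- (1 / t) *\<^sub>R (x - t *\<^sub>R b) \<in> span B"
          using t span_scale by blast
        then have "\<delta> \<le> dist b (- (1 / t) *\<^sub>R (x - t *\<^sub>R b))"
          unfolding \<delta>_def by (rule infdist_le)
        also have "\<dots> = norm x / \<bar>t\<bar>"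
          using False by (simp add: dist_norm algebra_simps)
        finally show ?thesis
          using False by (simp add: field_simps)
      qed simp
      then have "\<bar>t\<bar> * \<delta> \<le> r"
        using x by simp
      then have t\<rho>: "\<bar>t\<bar> \<le> \<rho>"
        using \<delta> by (simp add: \<rho>_def field_simps)
      have "norm (x - t *\<^sub>R b) \<le> norm x + \<bar>t\<bar> * norm b"
        by (metis norm_scaleR norm_triangle_ineq4)
      also have "\<dots> \<le> r + \<rho> * norm b"
        using x t\<rho> by (intro add_mono mult_right_mono) auto
      finally have "(t, x - t *\<^sub>R b) \<in> C"
        using t t\<rho> by (auto simp: C_def)
      moreover have "x = h (t, x - t *\<^sub>R b)"
        by (simp add: h_def)
      ultimately show "x \<in> cball 0 r \<inter> h ` C"
        using x by blast
    next
      fix x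
      assume x: "x \<in> cball 0 r \<inter> h ` C"
      then obtain t s where "x = t *\<^sub>R b + s" "s \<in> span B"
        by (auto simp: h_def C_def)
      then have "x - t *\<^sub>R b \<in> span B"
        by simp
      then show "x \<in> cball 0 r \<inter> span (insert b B)"
        using x span_breakdown_eq by blast
    qed
    moreover have "compact (h ` C)"
      unfolding C_def h_def
      by (intro compact_continuous_image continuous_intros compact_Times insert.IH) simp
    ultimately show ?thesis
      by (simp add: closed_Int_compact)
  qed
qed

section \<open>Powers of distances\<close>

text \<open>After division by \<open>a + b\<close> both summands lie in [0,1], where
  \<open>t \<le> t powr p\<close>.\<close>

lemma powr_add_le:
  fixes a b p :: real
  assumes "0 \<le> a" "0 \<le> b" "0 < p" "p \<le> 1"
  shows "(a + b) powr p \<le> a powr p + b powr p"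
proof (cases "a + b = 0")
  case True
  then show ?thesis
    using assms by simp
next
  case False
  then have s: "a + b > 0"
    using assms by simp
  have le: "c / (a + b) \<le> (c / (a + b)) powr p" if "0 \<le> c" "c \<le> a + b" for c
    using that s assms powr_mono'[of p 1 "c / (a + b)"] by simp
  have "1 = a / (a + b) + b / (a + b)"
    using s by (simp add: add_divide_distrib[symmetric])
  also have "\<dots> \<le> (a / (a + b)) powr p + (b / (a + b)) powr p"
    using le[of a] le[of b] assms by simp
  also have "\<dots> = (a powr p + b powr p) / (a + b) powr p"
    using assms by (simp add: powr_divide add_divide_distrib)
  finally show ?thesis
    using s by (simp add: field_simps)
qed

lemma dist_powr_triangle:
  assumes "0 < p" "p \<le> 1"
  shows "dist x z powr p \<le> dist x y powr p + dist y z powr p"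
proof -
  have "dist x z powr p \<le> (dist x y + dist y z) powr p"
    using assms by (intro powr_mono2 dist_triangle) auto
  also have "\<dots> \<le> dist x y powr p + dist y z powr p"
    using assms by (intro powr_add_le) auto
  finally show ?thesis .
qed

text \<open>This is where the exponent \<open>1\<close> is excluded: for \<open>p = 1\<close> the difference need not
  become small far away from \<open>x\<close>.\<close>

lemma dist_powr_diff_small_far_away:
  fixes x z :: "'a::metric_space"
  assumes "0 < p" "p < 1" "e > 0"
  obtains R where "\<And>y. R < dist z y \<Longrightarrow> dist x y powr p - dist z y powr p < e"
proof -
  \<comment> \<open>By concavity the difference is at most
    \<open>p * dist x z * t powr (p - 1)\<close> for \<open>t > 0\<close>, and \<open>p - 1\<close>
    is negative.\<close>
  have "((\<lambda>t. (t + dist x z) powr p - t powr p) \<longlongrightarrow> 0) at_top"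
    using assms by real_asymp
  then have "\<forall>\<^sub>F t in at_top. (t + dist x z) powr p - t powr p < e"
    using \<open>e > 0\<close> by (rule order_tendstoD)
  then obtain R where R: "\<And>t. R < t \<Longrightarrow> (t + dist x z) powr p - t powr p < e"
    by (auto simp: eventually_at_top_dense)
  show ?thesis
  proof
    fix y
    assume "R < dist z y"
    then have "(dist z y + dist x z) powr p - dist z y powr p < e"
      by (rule R)
    moreover have "dist x y powr p \<le> (dist z y + dist x z) powr p"
      using assms dist_triangle[of x y z] by (intro powr_mono2) auto
    ultimately show "dist x y powr p - dist z y powr p < e"
      by simp
  qed
qed

section \<open>Convergence of the coordinates and choice of the limit \<open>L\<close>\<close>

text \<open>A finite net reduces the claim to convergence at finitely many points; the common
  modulus of continuity, which \<open>F\<close> inherits, controls all other points.\<close>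

lemma uniform_limit_uniformly_equicontinuous:
  fixes f :: "nat \<Rightarrow> 'a::metric_space \<Rightarrow> 'b::metric_space"
  assumes compact: "compact (closure S)"
    and equi: "\<And>e. e > 0 \<Longrightarrow> \<exists>d>0. \<forall>n. \<forall>x\<in>S. \<forall>y\<in>S. dist x y < d \<longrightarrow> dist (f n x) (f n y) \<le> e"
    and lim: "\<And>x. x \<in> S \<Longrightarrow> (\<lambda>n. f n x) \<longlonglongrightarrow> F x"
  shows "uniform_limit S f F sequentially"
proof (rule uniform_limitI)
  fix e :: real
  assume "e > 0"
  then obtain d where "d > 0"
    and d: "\<And>n x y. x \<in> S \<Longrightarrow> y \<in> S \<Longrightarrow> dist x y < d \<Longrightarrow> dist (f n x) (f n y) \<le> e / 4"
    using equi[of "e / 4"] by auto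
  have dF: "dist (F x) (F y) \<le> e / 4" if "x \<in> S" "y \<in> S" "dist x y < d" for x y
    using tendsto_dist[OF lim[OF that(1)] lim[OF that(2)]] d[OF that] by (intro LIMSEQ_le_const2) auto
  \<comment> \<open>The centers are taken in \<open>S\<close> itself, since convergence is assumed
    only there.\<close>
  have "closure S \<subseteq> (\<Union>x\<in>S. ball x d)"
    using \<open>d > 0\<close> by (force simp: closure_approachable)
  then obtain T where T: "T \<subseteq> S" "finite T" "closure S \<subseteq> (\<Union>x\<in>T. ball x d)"
    using compactE_image[OF compact, of S "\<lambda>x. ball x d"] by auto
  have "\<forall>\<^sub>F n in sequentially. \<forall>t\<in>T. dist (f n t) (F t) < e / 4"
    using T \<open>e > 0\<close> by (intro eventually_ball_finite ballI tendstoD lim) auto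
  then show "\<forall>\<^sub>F n in sequentially. \<forall>x\<in>S. dist (f n x) (F x) < e"
  proof (eventually_elim, intro ballI)
    fix n x
    assume n: "\<forall>t\<in>T. dist (f n t) (F t) < e / 4" and "x \<in> S"
    then obtain t where t: "t \<in> T" "dist t x < d"
      using T(3) closure_subset[of S] \<open>x \<in> S\<close> by auto
    have "t \<in> S"
      using t T by blast
    have "dist (f n x) (F x) \<le> dist (f n t) (f n x) + dist (f n t) (F t) + dist (F t) (F x)"
      by metric
    moreover have "dist (f n t) (f n x) \<le> e / 4" "dist (F t) (F x) \<le> e / 4" "dist (f n t) (F t) < e / 4"
      using d dF n t \<open>t \<in> S\<close> \<open>x \<in> S\<close> by blast+
    ultimately show "dist (f n x) (F x) < e"
      using \<open>e > 0\<close> by linarith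
  qed
qed

text \<open>Far from \<open>z\<close> the bound comes from a single point \<open>w\<close> at which \<open>F\<close> is almost below \<open>L\<close>,
  near \<open>z\<close> from uniform convergence.\<close>

lemma eventually_holder_cone_le:
  fixes f :: "nat \<Rightarrow> 'a::metric_space \<Rightarrow> real"
  assumes \<alpha>: "0 < \<alpha>" "\<alpha> < 1" and K: "K > 0"
    and compact: "\<And>r. compact (cball z r)"
    and holder: "\<And>n. holder_on K \<alpha> M (f n)"
    and lim: "\<And>x. x \<in> M \<Longrightarrow> (\<lambda>n. f n x) \<longlonglongrightarrow> F x"
    and cone: "\<And>x. x \<in> M \<Longrightarrow> F x - K * dist z x powr \<alpha> \<le> L"
    and inf: "\<And>e. e > 0 \<Longrightarrow> \<exists>x\<in>M. F x < L + e"
    and e: "e > 0"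
  shows "\<forall>\<^sub>F n in sequentially. \<forall>x\<in>M. f n x - K * dist z x powr \<alpha> \<le> L + e"
proof -
  \<comment> \<open>The error \<open>e\<close> has three parts: \<open>F w\<close> against
    \<open>L\<close>, \<open>f n w\<close> against \<open>F w\<close>, and the far-away gap between
    the cones at \<open>w\<close> and at \<open>z\<close>.\<close>
  obtain w where w: "w \<in> M" "F w < L + e / 3"
    using inf[of "e / 3"] e by auto
  obtain R where R: "\<And>y. R < dist z y \<Longrightarrow> dist w y powr \<alpha> - dist z y powr \<alpha> < e / (3 * K)"
    using dist_powr_diff_small_far_away[OF \<alpha>, of "e / (3 * K)"] e K by (metis divide_pos_pos mult_pos_pos zero_less_numeral)
  define S where "S = M \<inter> cball z R"
  have "uniform_limit S f F sequentially"
  proof (rule uniform_limit_uniformly_equicontinuous)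
    show "compact (closure S)"
      using compact_Int_closed[OF compact[of R] closed_closure[of S]] closure_minimal[of S "cball z R"]
      by (simp add: S_def Int_absorb1)
  next
    fix e :: real
    assume "e > 0"
    \<comment> \<open>The solution of \<open>K * d powr \<alpha> = e\<close>, the same for all
      coordinates.\<close>
    define d where "d = (e / K) powr (1 / \<alpha>)"
    have "d > 0"
      using \<open>e > 0\<close> K by (simp add: d_def)
    moreover have "dist (f n x) (f n y) \<le> e" if "x \<in> S" "y \<in> S" "dist x y < d" for n x y
    proof -
      have "dist (f n x) (f n y) \<le> K * dist x y powr \<alpha>"
        using holder that by (auto simp: holder_on_def S_def)
      also have "\<dots> \<le> K * d powr \<alpha>"
        using that K \<alpha> by (intro mult_left_mono powr_mono2) auto
      also have "\<dots> = e"
        using K \<alpha> \<open>e > 0\<close> by (simp add: d_def powr_powr)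
      finally show ?thesis .
    qed
    ultimately show "\<exists>d>0. \<forall>n. \<forall>x\<in>S. \<forall>y\<in>S. dist x y < d \<longrightarrow> dist (f n x) (f n y) \<le> e"
      by blast
  qed (use lim in \<open>auto simp: S_def\<close>)
  then have "\<forall>\<^sub>F n in sequentially. \<forall>x\<in>S. dist (f n x) (F x) < e"
    using e by (rule uniform_limitD)
  moreover have "\<forall>\<^sub>F n in sequentially. dist (f n w) (F w) < e / 3"
    using e by (intro tendstoD lim w) auto
  ultimately show ?thesis
  proof (eventually_elim, intro ballI)
    fix n x
    assume near: "\<forall>x\<in>S. dist (f n x) (F x) < e" and fw: "dist (f n w) (F w) < e / 3" and "x \<in> M"
    show "f n x - K * dist z x powr \<alpha> \<le> L + e"
    proof (cases "x \<in> S")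
      case True
      then show ?thesis
        using near cone[OF \<open>x \<in> M\<close>] by (fastforce simp: dist_real_def)
    next
      case False
      then have "dist w x powr \<alpha> - dist z x powr \<alpha> < e / (3 * K)"
        using \<open>x \<in> M\<close> by (intro R) (auto simp: S_def)
      then have "K * dist w x powr \<alpha> - K * dist z x powr \<alpha> < e / 3"
        using K by (simp add: field_simps)
      moreover have "\<bar>f n w - f n x\<bar> \<le> K * dist w x powr \<alpha>"
        using holder w \<open>x \<in> M\<close> by (auto simp: holder_on_def dist_real_def)
      ultimately show ?thesis
        using fw w(2) unfolding dist_real_def by linarith
    qed
  qed
qed

text \<open>Take \<open>L\<close> to be the larger of \<open>sup (F - D)\<close> and \<open>inf F\<close>.\<close>

lemma admissible_limit_exists:
  fixes F D :: "'a \<Rightarrow> real"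
  assumes "M \<noteq> {}" and D: "\<And>x. x \<in> M \<Longrightarrow> 0 \<le> D x"
    and FD: "\<And>x y. x \<in> M \<Longrightarrow> y \<in> M \<Longrightarrow> F x - D x \<le> F y + D y"
  obtains L where "\<And>x. x \<in> M \<Longrightarrow> F x - D x \<le> L" "\<And>x. x \<in> M \<Longrightarrow> L \<le> F x + D x"
    "\<And>e. e > 0 \<Longrightarrow> \<exists>x\<in>M. F x < L + e" "\<And>e. e > 0 \<Longrightarrow> \<exists>x\<in>M. L - e < F x"
proof -
  define A where "A = (SUP x\<in>M. F x - D x)"
  obtain w where w: "w \<in> M"
    using \<open>M \<noteq> {}\<close> by blast
  have bdd: "bdd_above ((\<lambda>x. F x - D x) ` M)"
    using FD w by (intro bdd_aboveI2[of _ _ "F w + D w"]) auto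
  have A_ge: "F x - D x \<le> A" if "x \<in> M" for x
    unfolding A_def by (intro cSUP_upper that bdd)
  have A_le: "A \<le> F x + D x" if "x \<in> M" for x
    unfolding A_def by (intro cSUP_least \<open>M \<noteq> {}\<close> FD that)
  have A_approx: "\<exists>x\<in>M. A - e < F x" if "e > 0" for e
  proof -
    have "A - e < (SUP x\<in>M. F x - D x)"
      using that by (simp add: A_def)
    then obtain x where "x \<in> M" "A - e < F x - D x"
      using less_cSUP_iff[OF \<open>M \<noteq> {}\<close> bdd] by blast
    then show ?thesis
      using D by force
  qed
  show ?thesis
  \<comment> \<open>The split decides whether inf \<open>F\<close> is at most \<open>A\<close>. The
    infimum is formed only in the second case, where \<open>F\<close> is bounded below.\<close>
  proof (cases "\<forall>e>0. \<exists>x\<in>M. F x < A + e")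
    case True
    then show ?thesis
      using that[of A] A_ge A_le A_approx by blast
  next
    case False
    then obtain e0 where e0: "e0 > 0" "\<And>x. x \<in> M \<Longrightarrow> A + e0 \<le> F x"
      by (auto simp: not_less)
    define I where "I = (INF x\<in>M. F x)"
    have bddI: "bdd_below (F ` M)"
      using e0 by (intro bdd_belowI2[of _ "A + e0"]) auto
    have I_le: "I \<le> F x" if "x \<in> M" for x
      unfolding I_def by (intro cINF_lower that bddI)
    have "A + e0 \<le> I"
      unfolding I_def by (intro cINF_greatest \<open>M \<noteq> {}\<close> e0)
    then have "F x - D x \<le> I" if "x \<in> M" for x
      using A_ge[OF that] e0(1) by simp
    moreover have "I \<le> F x + D x" if "x \<in> M" for x
      using I_le[OF that] D[OF that] by simp
    moreover have "\<exists>x\<in>M. F x < I + e" if "e > 0" for e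
      using that cINF_less_iff[OF \<open>M \<noteq> {}\<close> bddI, of "I + e"] by (simp add: I_def)
    moreover have "\<exists>x\<in>M. I - e < F x" if "e > 0" for e
      using I_le[OF w] w that by force
    ultimately show ?thesis
      using that[of I] by blast
  qed
qed

section \<open>Extension to one further point\<close>

lemma holder_one_point_convergent:
  fixes f :: "nat \<Rightarrow> 'a::metric_space \<Rightarrow> real"
  assumes \<alpha>: "0 < \<alpha>" "\<alpha> < 1" and K: "K > 0"
    and compact: "\<And>r. compact (cball z r)"
    and holder: "\<And>n. holder_on K \<alpha> M (f n)"
    and conv: "\<And>x. x \<in> M \<Longrightarrow> convergent (\<lambda>n. f n x)"
  obtains g where "convergent g" "\<And>n x. x \<in> M \<Longrightarrow> dist (g n) (f n x) \<le> K * dist z x powr \<alpha>"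
proof (cases "M = {}")
  case True
  then show ?thesis
    using that[of "\<lambda>_. 0"] by (simp add: convergent_const)
next
  case False
  define D where "D = (\<lambda>x. K * dist z x powr \<alpha>)"
  define F where "F = (\<lambda>x. lim (\<lambda>n. f n x))"
  have D_nonneg: "0 \<le> D x" for x
    using K by (simp add: D_def)
  have D_triangle: "K * dist x y powr \<alpha> \<le> D x + D y" for x y
  proof -
    have "K * dist x y powr \<alpha> \<le> K * (dist x z powr \<alpha> + dist z y powr \<alpha>)"
      using K \<alpha> by (intro mult_left_mono dist_powr_triangle) auto
    then show ?thesis
      by (simp add: D_def distrib_left dist_commute)
  qed
  have lim: "(\<lambda>n. f n x) \<longlonglongrightarrow> F x" if "x \<in> M" for x
    using conv[OF that] by (simp add: F_def convergent_LIMSEQ_iff)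
  have fD: "f n x - D x \<le> f n y + D y" if "x \<in> M" "y \<in> M" for n x y
  proof -
    have "\<bar>f n x - f n y\<bar> \<le> K * dist x y powr \<alpha>"
      using holder that by (auto simp: holder_on_def dist_real_def)
    then show ?thesis
      using D_triangle[of x y] by linarith
  qed
  have FD: "F x - D x \<le> F y + D y" if "x \<in> M" "y \<in> M" for x y
    using fD[OF that] lim that
    by (intro LIMSEQ_le[of "\<lambda>n. f n x - D x" _ "\<lambda>n. f n y + D y"] tendsto_intros) auto
  obtain L where L: "\<And>x. x \<in> M \<Longrightarrow> F x - D x \<le> L" "\<And>x. x \<in> M \<Longrightarrow> L \<le> F x + D x"
    "\<And>e. e > 0 \<Longrightarrow> \<exists>x\<in>M. F x < L + e" "\<And>e. e > 0 \<Longrightarrow> \<exists>x\<in>M. L - e < F x"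
    using admissible_limit_exists[of M D F] False D_nonneg FD by blast
  define a where "a = (\<lambda>n. SUP x\<in>M. f n x - D x)"
  define b where "b = (\<lambda>n. INF x\<in>M. f n x + D x)"
  obtain w where w: "w \<in> M"
    using False by blast
  have a_ge: "f n x - D x \<le> a n" if "x \<in> M" for n x
    unfolding a_def
    using fD w by (intro cSUP_upper that bdd_aboveI2[of _ _ "f n w + D w"]) auto
  have b_le: "b n \<le> f n x + D x" if "x \<in> M" for n x
    unfolding b_def
    using fD w by (intro cINF_lower that bdd_belowI2[of _ "f n w - D w"]) auto
  have a_le_b: "a n \<le> b n" for n
    unfolding a_def b_def
    using fD by (intro cSUP_least cINF_greatest False) auto
  \<comment> \<open>The point of \<open>[a n, b n]\<close> nearest to \<open>L\<close>: always
    admissible, and close to \<open>L\<close> once \<open>a n\<close> is not far above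
    \<open>L\<close> and \<open>b n\<close> not far below.\<close>
  define g where "g = (\<lambda>n. max (a n) (min L (b n)))"
  have "g \<longlonglongrightarrow> L"
  proof (rule tendstoI)
    fix e :: real
    assume "e > 0"
    then have "e / 2 > 0"
      by simp
    have "\<forall>\<^sub>F n in sequentially. \<forall>x\<in>M. f n x - D x \<le> L + e / 2"
      using eventually_holder_cone_le[OF \<alpha> K compact holder lim _ _ \<open>e / 2 > 0\<close>, of L] L
      by (simp add: D_def)
    \<comment> \<open>The lower bound for \<open>b n\<close> is the upper bound for
      \<open>a n\<close> after a change of sign in \<open>f\<close>, \<open>F\<close> and
      \<open>L\<close>.\<close>
    moreover have "\<forall>\<^sub>F n in sequentially. \<forall>x\<in>M. - f n x - D x \<le> - L + e / 2"
      unfolding D_def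
    proof (rule eventually_holder_cone_le[OF \<alpha> K compact, where F = "\<lambda>x. - F x"])
      show "holder_on K \<alpha> M (\<lambda>x. - f n x)" for n
        using holder by (simp add: holder_on_def dist_minus)
      show "(\<lambda>n. - f n x) \<longlonglongrightarrow> - F x" if "x \<in> M" for x
        using lim[OF that] by (rule tendsto_minus)
      show "- F x - K * dist z x powr \<alpha> \<le> - L" if "x \<in> M" for x
        using L(2)[OF that] by (simp add: D_def)
      show "\<exists>x\<in>M. - F x < - L + e" if "e > 0" for e
        using L(4)[OF that] by force
    qed fact
    ultimately show "\<forall>\<^sub>F n in sequentially. dist (g n) L < e"
    proof eventually_elim
      case (elim n)
      have "a n \<le> L + e / 2"
        unfolding a_def using elim by (intro cSUP_least False) auto
      moreover have "L - e / 2 \<le> b n"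
        unfolding b_def using elim by (intro cINF_greatest False) force
      ultimately show ?case
        using \<open>e > 0\<close> by (auto simp: g_def dist_real_def)
    qed
  qed
  moreover have "dist (g n) (f n x) \<le> D x" if "x \<in> M" for n x
    using a_ge[OF that, of n] b_le[OF that, of n] a_le_b[of n] by (auto simp: g_def dist_real_def)
  ultimately show ?thesis
    using that[of g] by (auto simp: D_def convergent_def)
qed

text \<open>A supremum distance is bounded by a number exactly when all coordinate distances are, so
  the coordinates can be treated with the same \<open>K\<close>.\<close>

lemma holder_one_point_c_space:
  fixes f :: "'a::metric_space \<Rightarrow> nat \<Rightarrow>\<^sub>C real"
  assumes \<alpha>: "0 < \<alpha>" "\<alpha> < 1" and K: "K > 0"
    and compact: "\<And>r. compact (cball z r)"
    and f: "f \<in> M \<rightarrow> c_space" and holder: "holder_on K \<alpha> M f"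
  obtains v where "v \<in> c_space" "\<And>x. x \<in> M \<Longrightarrow> dist v (f x) \<le> K * dist z x powr \<alpha>"
proof -
  have "holder_on K \<alpha> M (\<lambda>x. f x n)" for n
    using holder dist_bounded order_trans unfolding holder_on_def by blast
  moreover have "convergent (\<lambda>n. f x n)" if "x \<in> M" for x
    using f that by (auto simp: c_space_def)
  ultimately obtain g where g: "convergent g"
    "\<And>n x. x \<in> M \<Longrightarrow> dist (g n) (f x n) \<le> K * dist z x powr \<alpha>"
    using holder_one_point_convergent[OF \<alpha> K compact, of M "\<lambda>n x. f x n"] by blast
  obtain v where v: "v \<in> c_space" "g = apply_bcontfun v"
    using g(1) apply_bcontfun_image_c_space by blast
  show ?thesis
    using that[of v] v g(2) by (auto intro: dist_bound)
qed

section \<open>From one point to the whole space\<close>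

text \<open>Partial maps are handled as graphs, so that chains have unions. The bound makes a graph
  single-valued: at equal arguments its right side is
  \<open>K * 0 powr \<alpha> = 0\<close>.\<close>

lemma holder_graph_apply:
  assumes "\<And>p q. p \<in> G \<Longrightarrow> q \<in> G \<Longrightarrow> dist (snd p) (snd q) \<le> K * dist (fst p) (fst q) powr \<alpha>"
  obtains h where "\<And>x u. (x, u) \<in> G \<Longrightarrow> h x = u" "holder_on K \<alpha> (fst ` G) h"
proof
  define h where "h = (\<lambda>x. SOME u. (x, u) \<in> G)"
  show h: "h x = u" if "(x, u) \<in> G" for x u
  proof -
    have "(x, h x) \<in> G"
      unfolding h_def using that by (rule someI)
    then show ?thesis
      using assms[OF _ that, of "(x, h x)"] by simp
  qed
  show "holder_on K \<alpha> (fst ` G) h"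
    using assms h by (force simp: holder_on_def)
qed

text \<open>Zorn's lemma is applied to the graphs extending that of \<open>f\<close>; a maximal one
  has full domain, since the one-point step would otherwise enlarge it.\<close>

lemma holder_extension_if_one_point_extension:
  fixes f :: "'a::metric_space \<Rightarrow> 'b::metric_space"
  assumes one: "\<And>M (f :: 'a \<Rightarrow> 'b) z. f \<in> M \<rightarrow> Y \<Longrightarrow> holder_on K \<alpha> M f \<Longrightarrow>
      \<exists>v\<in>Y. \<forall>x\<in>M. dist v (f x) \<le> K * dist z x powr \<alpha>"
    and f: "f \<in> M \<rightarrow> Y" "holder_on K \<alpha> M f"
  shows "\<exists>g. g \<in> UNIV \<rightarrow> Y \<and> holder_on K \<alpha> UNIV g \<and> (\<forall>x\<in>M. g x = f x)"
proof -
  define H where "H = (\<lambda>p q::'a \<times> 'b. dist (snd p) (snd q) \<le> K * dist (fst p) (fst q) powr \<alpha>)"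
  define \<G> where "\<G> = {G. (\<lambda>x. (x, f x)) ` M \<subseteq> G \<and> G \<subseteq> UNIV \<times> Y \<and> (\<forall>p\<in>G. \<forall>q\<in>G. H p q)}"
  have "(\<lambda>x. (x, f x)) ` M \<in> \<G>"
    using f by (auto simp: \<G>_def H_def holder_on_def)
  then have "\<G> \<noteq> {}"
    by blast
  moreover have "\<Union>\<C> \<in> \<G>" if "\<C> \<noteq> {}" "subset.chain \<G> \<C>" for \<C>
  proof -
    have sub: "\<C> \<subseteq> \<G>" and chain: "\<And>A B. A \<in> \<C> \<Longrightarrow> B \<in> \<C> \<Longrightarrow> A \<subseteq> B \<or> B \<subseteq> A"
      using that(2) by (auto simp: subset_chain_def)
    have "H p q" if "p \<in> \<Union>\<C>" "q \<in> \<Union>\<C>" for p q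
    proof -
      obtain A B where "A \<in> \<C>" "B \<in> \<C>" "p \<in> A" "q \<in> B"
        using \<open>p \<in> \<Union>\<C>\<close> \<open>q \<in> \<Union>\<C>\<close> by blast
      then obtain C where "C \<in> \<C>" "p \<in> C" "q \<in> C"
        using chain by blast
      then show ?thesis
        using sub by (auto simp: \<G>_def)
    qed
    moreover have "(\<lambda>x. (x, f x)) ` M \<subseteq> A \<and> A \<subseteq> UNIV \<times> Y" if "A \<in> \<C>" for A
      using subsetD[OF sub that] by (simp add: \<G>_def)
    then have "(\<lambda>x. (x, f x)) ` M \<subseteq> \<Union>\<C>" "\<Union>\<C> \<subseteq> UNIV \<times> Y"
      using \<open>\<C> \<noteq> {}\<close> by blast+
    ultimately show ?thesis
      unfolding \<G>_def by simp
  qed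
  ultimately obtain G where G: "G \<in> \<G>" and max: "\<And>G'. G' \<in> \<G> \<Longrightarrow> G \<subseteq> G' \<Longrightarrow> G' = G"
    using subset_Zorn_nonempty[of \<G>] by blast
  obtain h where h: "\<And>x u. (x, u) \<in> G \<Longrightarrow> h x = u" "holder_on K \<alpha> (fst ` G) h"
    using holder_graph_apply[of G K \<alpha>] G by (auto simp: \<G>_def H_def)
  have hY: "h \<in> fst ` G \<rightarrow> Y"
    using G h(1) by (force simp: \<G>_def)
  have dom: "z \<in> fst ` G" for z
  proof -
    obtain v where v: "v \<in> Y" "\<And>x. x \<in> fst ` G \<Longrightarrow> dist v (h x) \<le> K * dist z x powr \<alpha>"
      using one[OF hY h(2)] by blast
    \<comment> \<open>This covers a \<open>z\<close> already in the domain: there the bound forces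
      \<open>v = h z\<close>.\<close>
    have "H (z, v) p \<and> H p (z, v)" if "p \<in> G" for p
      using v(2)[of "fst p"] h(1)[of "fst p" "snd p"] that by (simp add: H_def dist_commute)
    moreover have "H (z, v) (z, v)"
      by (simp add: H_def)
    ultimately have "insert (z, v) G \<in> \<G>"
      using G v(1) by (auto simp: \<G>_def)
    then show ?thesis
      using max by force
  qed
  then have "fst ` G = UNIV"
    by blast
  moreover have "h x = f x" if "x \<in> M" for x
    using h(1) G that by (auto simp: \<G>_def)
  ultimately show ?thesis
    using hY h(2) by auto
qed

theorem theorem3p5:
  assumes "\<exists>B :: 'a::real_normed_vector set. finite B \<and> span B = UNIV"
  shows "{0<..<1} \<subseteq> holder_extension_exponents (UNIV :: 'a set) c_space"
proof
  fix \<alpha> :: real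
  assume "\<alpha> \<in> {0<..<1}"
  then have \<alpha>: "0 < \<alpha>" "\<alpha> < 1"
    by auto
  \<comment> \<open>Finite dimension enters here, through compactness of closed balls, and nowhere
    else.\<close>
  have "compact (cball (0::'a) r)" for r
    using assms compact_cball_Int_span by (metis Int_UNIV_right)
  then have compact: "compact (cball (z::'a) r)" for z r
    using compact_translation[of "cball 0 r" z] by (simp add: cball_translation)
  have "\<exists>g. g \<in> (UNIV :: 'a set) \<rightarrow> c_space \<and> holder_on K \<alpha> UNIV g \<and> (\<forall>x\<in>M. g x = f x)"
    if "K > 0" "f \<in> M \<rightarrow> c_space" "holder_on K \<alpha> M f" for K M and f :: "'a \<Rightarrow> nat \<Rightarrow>\<^sub>C real"
  proof (rule holder_extension_if_one_point_extension[OF _ that(2,3)])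
    fix N z and h :: "'a \<Rightarrow> nat \<Rightarrow>\<^sub>C real"
    assume "h \<in> N \<rightarrow> c_space" "holder_on K \<alpha> N h"
    then show "\<exists>v\<in>c_space. \<forall>x\<in>N. dist v (h x) \<le> K * dist z x powr \<alpha>"
      using holder_one_point_c_space[OF \<alpha> \<open>K > 0\<close> compact] by metis
  qed
  then show "\<alpha> \<in> holder_extension_exponents (UNIV :: 'a set) c_space"
    using \<alpha> by (simp add: holder_extension_exponents_def)
qed

end
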